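(* Let $k:[0,1]^2\to[0,1]$ be a positive, symmetric, measurable function. Assume that there exists $m\in[0,1]$ such that $k(x,y)\le k(m,m)$ for all $x,y\in[0,1]$ and that $k$ is continuous at the point $(m,m)$. Let $\lambda_n=cn$ with $c\in\mathbb{R}^+$ such that $c>k(m,m)$, and let $(I_n(k_n))_{n\ge 1}$ be a sequence of inhomogeneous random graphs, $I_n(k_n)$ having vertex set $[n]$ and kernel $k_n=k/\lambda_n$. Then for any $\varepsilon>0$, $$\mathbb{P}\left(\Delta(I_n(k_n))\in[(1-\varepsilon)\Delta_n,(1+\varepsilon)\Delta_n]\right)\to 1\quad\text{as } n\to\infty,$$ where $\Delta_n:=\log(n)/\log(\log(n))$ and $\Delta(G)$ denotes the maximum degree of $G$.
   Context: The inhomogeneous random graph $I_n(k_n)$ with kernel $k_n=k/\lambda_n$ is the random undirected simple graph on vertex set $[n]=\{1,\dots,n\}$ constructed as follows: the vertices are assigned independent weights $W_i\sim\mathrm{Unif}(0,1)$, $i\in[n]$, and, conditionally on $(W_i)_{i=1}^n$, each pair of vertices $i\ne j$ is joined by an edge independently with probability $k(W_i,W_j)/\lambda_n$. The maximum degree of a graph $G=(V,E)$ is $\Delta(G)=\max_{v\in V}d(v)$, where $d(v)$ is the degree of $v$. $\log$ is the natural logarithm. *)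

theory Defs
  imports "HOL-Probability.Probability"
begin

text \<open>A graph is a pair of a vertex set and a set of edges, each edge being a set of two vertices.\<close>

type_synonym graph = "nat set \<times> nat set set"

definition simple_graphs :: "nat \<Rightarrow> graph set" where
  "simple_graphs n = {({1..n}, E) |E. E \<subseteq> {{i, j} |i j. i \<in> {1..n} \<and> j \<in> {1..n} \<and> i \<noteq> j}}"

definition vertex_degree :: "graph \<Rightarrow> nat \<Rightarrow> nat" where
  "vertex_degree G v = card {e \<in> snd G. v \<in> e}"

definition max_degree :: "graph \<Rightarrow> nat" where
  "max_degree G = Max (vertex_degree G ` fst G)"

text \<open>The uniform distribution on the open unit interval, with that interval (not the real line)
  as underlying space: kernels are only required to be measurable on the unit square.\<close>

definition unif01 :: "real measure" where
  "unif01 = restrict_space lborel {0<..<1}"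

text \<open>Unordered pairs of vertices are represented by the ordered pairs with \<open>i < j\<close>.\<close>

definition vertex_pairs :: "nat \<Rightarrow> (nat \<times> nat) set" where
  "vertex_pairs n = {(i, j). 1 \<le> i \<and> i < j \<and> j \<le> n}"

definition graph_of :: "nat \<Rightarrow> (nat \<times> nat \<Rightarrow> bool) \<Rightarrow> graph" where
  "graph_of n b = ({1..n}, {{i, j} |i j. (i, j) \<in> vertex_pairs n \<and> b (i, j)})"

text \<open>The conditional law of the graph given the weights \<open>w\<close>. Note that \<open>bernoulli_pmf p\<close> clips
  \<open>p\<close> to the unit interval; this has no effect for kernels with values in the unit interval.\<close>

definition conditional_law :: "nat \<Rightarrow> (real \<times> real \<Rightarrow> real) \<Rightarrow> (nat \<Rightarrow> real) \<Rightarrow> graph measure" where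
  "conditional_law n \<kappa> w =
     distr (measure_pmf (Pi_pmf (vertex_pairs n) False (\<lambda>(i, j). bernoulli_pmf (\<kappa> (w i, w j)))))
       (count_space (simple_graphs n)) (graph_of n)"

definition inhomogeneous_random_graph :: "nat \<Rightarrow> (real \<times> real \<Rightarrow> real) \<Rightarrow> graph measure" where
  "inhomogeneous_random_graph n \<kappa> =
     (\<Pi>\<^sub>M i\<in>{1..n}. unif01) \<bind> conditional_law n \<kappa>"

end

theory Submission
  imports Defs "HOL-Real_Asymp.Real_Asymp"
begin

text \<open>Every edge has probability at most \<open>k (m, m) / (c * n) < 1 / n\<close>. Hence a fixed vertex has degree at
least \<open>t\<close> with probability at most \<open>1 / fact t\<close>, whatever the weights are, and some vertex does with
probability at most \<open>n / fact t\<close> (\<open>measure_max_degree_ge\<close>). Since \<open>ln (fact t)\<close> behaves like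
\<open>t * ln t\<close>, this tends to zero for \<open>t = (1 + \<epsilon>) * ln n / ln (ln n)\<close> (\<open>tendsto_n_over_fact\<close>).

Conversely, the kernel is at least \<open>k (m, m) / 2 > 0\<close> on a square \<open>J \<times> J\<close> for an interval \<open>J\<close> of
positive length at \<open>m\<close>, by continuity. With high probability a positive proportion of the vertices has
its weight in \<open>J\<close> (\<open>prob_few_coordinates_in_set\<close>). Between two disjoint sets \<open>A\<close> and \<open>B\<close> of \<open>s\<close> such
vertices, edges have probability at least \<open>q / n\<close>. Given the weights, the numbers of neighbours in \<open>B\<close>
of the vertices in \<open>A\<close> are independent, so the probability that none of them
reaches \<open>t\<close> is exponentially small in the mean number of vertices that do, which is of order at
least \<open>s * (s choose t) * (q / n) ^ t\<close> (\<open>prob_max_degree_less\<close>). For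
\<open>t = (1 - \<epsilon>) * ln n / ln (ln n)\<close> this mean tends to infinity (\<open>tendsto_exp_binomial\<close>).

The two bounds meet because \<open>k (m, m)\<close>, \<open>c\<close> and the length of \<open>J\<close> enter as a constant factor for each
edge or vertex: they change the exponent \<open>t * ln t\<close> by \<open>O(t)\<close>, which is of lower order.\<close>

section \<open>Counting true coordinates of a product of Bernoulli distributions\<close>

lemma prob_Pi_pmf_cylinder:
  assumes "finite D" "C \<subseteq> D"
  shows "measure_pmf.prob (Pi_pmf D d p) {b. \<forall>x\<in>C. b x \<in> B x} = (\<Prod>x\<in>C. measure_pmf.prob (p x) (B x))"
proof -
  define B' where "B' = (\<lambda>x. if x \<in> C then B x else UNIV)"
  have "{b. \<forall>x\<in>C. b x \<in> B x} = Pi D B'"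
    using assms(2) by (auto simp: B'_def Pi_def)
  hence "measure_pmf.prob (Pi_pmf D d p) {b. \<forall>x\<in>C. b x \<in> B x} = (\<Prod>x\<in>D. measure_pmf.prob (p x) (B' x))"
    by (simp add: measure_Pi_pmf_Pi[OF assms(1)])
  also have "\<dots> = (\<Prod>x\<in>C. measure_pmf.prob (p x) (B x))"
    using assms by (intro prod.mono_neutral_cong_right) (auto simp: B'_def)
  finally show ?thesis .
qed

text \<open>Union bound over the sets of \<open>t\<close> coordinates that could all be true.\<close>
lemma prob_card_ge_le:
  fixes r :: "'a \<Rightarrow> real"
  assumes "finite D" "C \<subseteq> D" and r: "\<And>x. x \<in> C \<Longrightarrow> 0 \<le> r x \<and> r x \<le> \<rho>" and "\<rho> \<le> 1"
  shows "measure_pmf.prob (Pi_pmf D False (\<lambda>x. bernoulli_pmf (r x))) {b. t \<le> card {x\<in>C. b x}}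
           \<le> real (card C choose t) * \<rho> ^ t"
proof -
  let ?P = "measure_pmf.prob (Pi_pmf D False (\<lambda>x. bernoulli_pmf (r x)))"
  define TT where "TT = {T. T \<subseteq> C \<and> card T = t}"
  have fC: "finite C" using assms finite_subset by blast
  have fT: "finite TT" unfolding TT_def using fC by auto
  have "{b. t \<le> card {x\<in>C. b x}} \<subseteq> (\<Union>T\<in>TT. {b. \<forall>x\<in>T. b x \<in> {True}})"
  proof
    fix b assume "b \<in> {b. t \<le> card {x\<in>C. b x}}"
    then obtain T where "T \<subseteq> {x\<in>C. b x}" "card T = t"
      by (metis mem_Collect_eq obtain_subset_with_card_n)
    thus "b \<in> (\<Union>T\<in>TT. {b. \<forall>x\<in>T. b x \<in> {True}})" by (auto simp: TT_def)
  qed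
  hence "?P {b. t \<le> card {x\<in>C. b x}} \<le> ?P (\<Union>T\<in>TT. {b. \<forall>x\<in>T. b x \<in> {True}})"
    by (intro measure_pmf.finite_measure_mono) auto
  also have "\<dots> \<le> (\<Sum>T\<in>TT. ?P {b. \<forall>x\<in>T. b x \<in> {True}})"
    using fT by (intro measure_pmf.finite_measure_subadditive_finite) auto
  also have "\<dots> \<le> (\<Sum>T\<in>TT. \<rho> ^ t)"
  proof (rule sum_mono)
    fix T assume "T \<in> TT"
    hence T: "T \<subseteq> C" "card T = t" by (auto simp: TT_def)
    have "?P {b. \<forall>x\<in>T. b x \<in> {True}} = (\<Prod>x\<in>T. measure_pmf.prob (bernoulli_pmf (r x)) {True})"
      using assms T by (intro prob_Pi_pmf_cylinder) auto
    also have "\<dots> \<le> (\<Prod>x\<in>T. \<rho>)"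
      using r T assms(4) by (intro prod_mono) (force simp: measure_pmf_single)
    finally show "?P {b. \<forall>x\<in>T. b x \<in> {True}} \<le> \<rho> ^ t" using T by simp
  qed
  also have "\<dots> = real (card C choose t) * \<rho> ^ t"
    using n_subsets[OF fC] by (simp add: TT_def)
  finally show ?thesis .
qed

text \<open>The number of true coordinates is bounded below without comparing it to a binomial variable: for
each \<open>T\<close> with \<open>t\<close> elements, the event that the true coordinates in \<open>C\<close> are exactly those in \<open>T\<close>
is a cylinder, and these events are disjoint.\<close>
lemma prob_card_ge_ge:
  fixes r :: "'a \<Rightarrow> real"
  assumes "finite D" "C \<subseteq> D" and r: "\<And>x. x \<in> C \<Longrightarrow> q \<le> r x \<and> r x \<le> \<rho>"
    and "0 \<le> q" "\<rho> \<le> 1"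
  shows "real (card C choose t) * q ^ t * (1 - \<rho>) ^ card C \<le>
     measure_pmf.prob (Pi_pmf D False (\<lambda>x. bernoulli_pmf (r x))) {b. t \<le> card {x\<in>C. b x}}"
proof -
  let ?P = "measure_pmf.prob (Pi_pmf D False (\<lambda>x. bernoulli_pmf (r x)))"
  define TT where "TT = {T. T \<subseteq> C \<and> card T = t}"
  have fC: "finite C" using assms finite_subset by blast
  have fT: "finite TT" unfolding TT_def using fC by auto
  have "real (card C choose t) * q ^ t * (1 - \<rho>) ^ card C = (\<Sum>T\<in>TT. q ^ t * (1 - \<rho>) ^ card C)"
    using n_subsets[OF fC] by (simp add: TT_def)
  also have "\<dots> \<le> (\<Sum>T\<in>TT. ?P {b. \<forall>x\<in>C. b x \<in> {x \<in> T}})"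
  proof (rule sum_mono)
    fix T assume "T \<in> TT"
    hence T: "T \<subseteq> C" "card T = t" "finite T" using fC finite_subset by (auto simp: TT_def)
    show "q ^ t * (1 - \<rho>) ^ card C \<le> ?P {b. \<forall>x\<in>C. b x \<in> {x \<in> T}}"
    proof (cases "C = {}")
      case False
      then obtain y where "y \<in> C" by auto
      with r[of y] assms have "0 \<le> \<rho>" by linarith
      have "q ^ t * (1 - \<rho>) ^ card C \<le> q ^ t * (1 - \<rho>) ^ card (C - T)"
        using assms \<open>0 \<le> \<rho>\<close> fC T
        by (intro mult_left_mono power_decreasing) (auto intro!: card_mono)
      also have "\<dots> = (\<Prod>x\<in>T. q) * (\<Prod>x\<in>C-T. 1 - \<rho>)" using T by simp
      also have "\<dots> \<le> (\<Prod>x\<in>T. measure_pmf.prob (bernoulli_pmf (r x)) {x \<in> T}) *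
                      (\<Prod>x\<in>C-T. measure_pmf.prob (bernoulli_pmf (r x)) {x \<in> T})"
      proof (intro mult_mono prod_mono conjI prod_nonneg)
        fix x assume x: "x \<in> T"
        hence "x \<in> C" using T(1) by auto
        from r[OF this] assms(5) have "q \<le> r x" "r x \<le> 1" by auto
        thus "q \<le> measure_pmf.prob (bernoulli_pmf (r x)) {x \<in> T}"
          using x assms(4) by (simp add: measure_pmf_single)
      next
        fix x assume x: "x \<in> C - T"
        hence "0 \<le> r x" "r x \<le> \<rho>" using r[of x] assms(4) by auto
        thus "1 - \<rho> \<le> measure_pmf.prob (bernoulli_pmf (r x)) {x \<in> T}"
          using x assms(5) by (simp add: measure_pmf_single)
      qed (use assms(4,5) in auto)
      also have "\<dots> = (\<Prod>x\<in>C. measure_pmf.prob (bernoulli_pmf (r x)) {x \<in> T})"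
        by (subst prod.subset_diff[OF T(1) fC]) (simp only: mult.commute)
      also have "\<dots> = ?P {b. \<forall>x\<in>C. b x \<in> {x \<in> T}}"
        using assms(1,2) by (intro prob_Pi_pmf_cylinder[symmetric]) auto
      finally show ?thesis .
    qed (use T in auto)
  qed
  also have "\<dots> = ?P (\<Union>T\<in>TT. {b. \<forall>x\<in>C. b x \<in> {x \<in> T}})"
    using fT by (intro measure_pmf.finite_measure_finite_Union[symmetric])
      (auto simp: disjoint_family_on_def TT_def)
  also have "\<dots> \<le> ?P {b. t \<le> card {x\<in>C. b x}}"
  proof (intro measure_pmf.finite_measure_mono subsetI)
    fix b assume "b \<in> (\<Union>T\<in>TT. {b. \<forall>x\<in>C. b x \<in> {x \<in> T}})"
    then obtain T where "T \<in> TT" "\<forall>x\<in>C. b x = (x \<in> T)" by auto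
    hence "{x\<in>C. b x} = T" by (auto simp: TT_def)
    with \<open>T \<in> TT\<close> show "b \<in> {b. t \<le> card {x\<in>C. b x}}" by (auto simp: TT_def)
  qed auto
  finally show ?thesis .
qed

text \<open>Events that look at disjoint blocks of coordinates are independent. The hypothesis on \<open>Q\<close> says
that \<open>Q v b\<close> depends on \<open>b\<close> through the block \<open>K v\<close> only.\<close>
lemma prob_Pi_pmf_disjoint_blocks:
  fixes d :: "'b :: countable"
  assumes "finite D" "finite A" "A \<noteq> {}" "\<And>v. v \<in> A \<Longrightarrow> K v \<subseteq> D" "disjoint_family_on K A"
    and Q: "\<And>v b. v \<in> A \<Longrightarrow> Q v (restrict b (K v)) = Q v b"
  shows "measure_pmf.prob (Pi_pmf D d p) {b. \<forall>v\<in>A. Q v b}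
       = (\<Prod>v\<in>A. measure_pmf.prob (Pi_pmf D d p) {b. Q v b})"
proof -
  have blocks: "prob_space.indep_vars (measure_pmf (Pi_pmf D d p)) (\<lambda>v. Pi\<^sub>M (K v) (\<lambda>_. count_space UNIV))
             (\<lambda>v b. restrict (\<lambda>i. b i) (K v)) A"
    by (rule prob_space.indep_vars_restrict
          [OF measure_pmf.prob_space_axioms indep_vars_Pi_pmf[OF assms(1)]]) (use assms in auto)
  have "prob_space.indep_vars (measure_pmf (Pi_pmf D d p)) (\<lambda>v. count_space UNIV) (\<lambda>v b. Q v (restrict b (K v))) A"
  proof (rule prob_space.indep_vars_compose2[OF measure_pmf.prob_space_axioms blocks])
    fix v assume "v \<in> A"
    hence "finite (K v)" using assms(1,4) finite_subset by blast
    thus "Q v \<in> Pi\<^sub>M (K v) (\<lambda>_. count_space UNIV) \<rightarrow>\<^sub>M count_space UNIV"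
      by (subst count_space_PiM_finite) auto
  qed
  from prob_space.indep_varsD_finite[OF measure_pmf.prob_space_axioms this assms(3,2), of "\<lambda>_. {True}"]
  have "measure_pmf.prob (Pi_pmf D d p) {b. \<forall>v\<in>A. Q v (restrict b (K v))}
       = (\<Prod>v\<in>A. measure_pmf.prob (Pi_pmf D d p) {b. Q v (restrict b (K v))})"
    by (simp add: vimage_def Collect_ball_eq)
  thus ?thesis using Q by simp
qed

section \<open>The maximum degree for independent edges\<close>

definition star :: "nat \<Rightarrow> nat \<Rightarrow> (nat \<times> nat) set" where
  "star n v = {e \<in> vertex_pairs n. fst e = v \<or> snd e = v}"

text \<open>The pairs that join \<open>v\<close> to the vertices in \<open>B\<close>. The smaller vertex comes first, since unordered
pairs are represented by increasing ordered ones and \<open>B\<close> may contain vertices on both sides of \<open>v\<close>.\<close>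
definition block :: "nat \<Rightarrow> nat set \<Rightarrow> (nat \<times> nat) set" where
  "block v B = (\<lambda>j. (min v j, max v j)) ` B"

lemma finite_vertex_pairs: "finite (vertex_pairs n)"
  by (rule finite_subset[of _ "{1..n} \<times> {1..n}"]) (auto simp: vertex_pairs_def)

lemma card_block: "card (block v B) = card B"
  unfolding block_def by (intro card_image inj_onI) (auto simp: min_def max_def split: if_splits)

lemma block_subset_star:
  assumes "v \<in> {1..n}" "B \<subseteq> {1..n}" "v \<notin> B"
  shows "block v B \<subseteq> star n v"
proof
  fix e assume "e \<in> block v B"
  then obtain j where "j \<in> B" "e = (min v j, max v j)" by (auto simp: block_def)
  moreover have "j \<noteq> v" "j \<in> {1..n}" using \<open>j \<in> B\<close> assms by auto
  ultimately show "e \<in> star n v"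
    using assms(1) by (auto simp: star_def vertex_pairs_def min_def max_def)
qed

lemma card_star_le:
  assumes "v \<in> {1..n}"
  shows "card (star n v) \<le> n"
proof -
  have "star n v \<subseteq> block v {1..n}"
  proof
    fix e assume "e \<in> star n v"
    then obtain i j where "e = (i, j)" "1 \<le> i" "i < j" "j \<le> n" "i = v \<or> j = v"
      by (cases e) (auto simp: star_def vertex_pairs_def)
    thus "e \<in> block v {1..n}"
      by (auto simp: block_def intro: image_eqI[of _ _ i] image_eqI[of _ _ j])
  qed
  hence "card (star n v) \<le> card (block v {1..n})"
    by (intro card_mono) (auto simp: block_def)
  thus ?thesis by (simp add: card_block)
qed

text \<open>This is why the lower bound uses two disjoint sets of vertices: a pair that joins \<open>A\<close> to \<open>B\<close>
has a single endpoint in \<open>A\<close>, hence belongs to one block only.\<close>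
lemma disjoint_blocks:
  assumes "A \<inter> B = {}"
  shows "disjoint_family_on (\<lambda>v. block v B) A"
  unfolding disjoint_family_on_def
proof (intro ballI impI equals0I)
  fix v v' e assume v: "v \<in> A" "v' \<in> A" "v \<noteq> v'" "e \<in> block v B \<inter> block v' B"
  then obtain j j' where "j \<in> B" "j' \<in> B" "e = (min v j, max v j)" "e = (min v' j', max v' j')"
    by (auto simp: block_def)
  moreover from this have "v = j'"
    using v by (auto simp: min_def max_def split: if_splits)
  ultimately show False using assms v by auto
qed

lemma vertex_degree_graph_of: "vertex_degree (graph_of n b) v = card {e \<in> star n v. b e}"
proof -
  have "{e \<in> snd (graph_of n b). v \<in> e} = (\<lambda>(i, j). {i, j}) ` {e \<in> star n v. b e}"
  proof (intro equalityI subsetI)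
    fix e assume "e \<in> {e \<in> snd (graph_of n b). v \<in> e}"
    then obtain i j where "e = {i, j}" "(i, j) \<in> vertex_pairs n" "b (i, j)" "v = i \<or> v = j"
      by (auto simp: graph_of_def)
    thus "e \<in> (\<lambda>(i, j). {i, j}) ` {e \<in> star n v. b e}"
      by (intro image_eqI[of _ _ "(i, j)"]) (auto simp: star_def)
  qed (auto simp: graph_of_def star_def)
  moreover have "inj_on (\<lambda>(i, j). {i, j}) {e \<in> star n v. b e}"
  proof (rule inj_onI)
    fix x y assume "x \<in> {e \<in> star n v. b e}" "y \<in> {e \<in> star n v. b e}"
      "(\<lambda>(i, j). {i, j}) x = (\<lambda>(i, j). {i, j}) y"
    moreover obtain i j k l where "x = (i, j)" "y = (k, l)" by (metis surj_pair)
    ultimately have "i < j" "k < l" "{i, j} = {k, l}" "x = (i, j)" "y = (k, l)"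
      by (auto simp: star_def vertex_pairs_def)
    thus "x = y" by (metis doubleton_eq_iff less_asym')
  qed
  ultimately show ?thesis by (simp add: vertex_degree_def card_image)
qed

lemma graph_of_in_simple_graphs: "graph_of n b \<in> simple_graphs n"
proof -
  have "{{i, j} |i j. (i, j) \<in> vertex_pairs n \<and> b (i, j)}
          \<subseteq> {{i, j} |i j. i \<in> {1..n} \<and> j \<in> {1..n} \<and> i \<noteq> j}"
  proof
    fix e assume "e \<in> {{i, j} |i j. (i, j) \<in> vertex_pairs n \<and> b (i, j)}"
    then obtain i j where "e = {i, j}" "1 \<le> i" "i < j" "j \<le> n"
      by (auto simp: vertex_pairs_def)
    hence "e = {i, j} \<and> i \<in> {1..n} \<and> j \<in> {1..n} \<and> i \<noteq> j" by auto
    thus "e \<in> {{i, j} |i j. i \<in> {1..n} \<and> j \<in> {1..n} \<and> i \<noteq> j}" by blast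
  qed
  thus ?thesis unfolding graph_of_def simple_graphs_def by blast
qed

lemma max_degree_graph_of_ge_iff:
  assumes "1 \<le> n"
  shows "t \<le> max_degree (graph_of n b) \<longleftrightarrow> (\<exists>v\<in>{1..n}. t \<le> vertex_degree (graph_of n b) v)"
  using assms unfolding max_degree_def by (subst Max_ge_iff) (auto simp: graph_of_def)

text \<open>A vertex has at most \<open>n\<close> potential neighbours, so its degree reaches \<open>t\<close> with probability at most
\<open>(n choose t) * (1 / n) ^ t \<le> 1 / fact t\<close>; sum over the vertices.\<close>
lemma prob_max_degree_ge:
  fixes r :: "nat \<times> nat \<Rightarrow> real"
  assumes "1 \<le> n" and r: "\<And>e. e \<in> vertex_pairs n \<Longrightarrow> 0 \<le> r e \<and> r e \<le> 1 / n"
  shows "measure_pmf.prob (Pi_pmf (vertex_pairs n) False (\<lambda>e. bernoulli_pmf (r e)))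
           {b. t \<le> max_degree (graph_of n b)} \<le> n / fact t"
proof -
  let ?P = "measure_pmf.prob (Pi_pmf (vertex_pairs n) False (\<lambda>e. bernoulli_pmf (r e)))"
  have "?P {b. t \<le> max_degree (graph_of n b)} = ?P (\<Union>v\<in>{1..n}. {b. t \<le> card {e \<in> star n v. b e}})"
    using assms(1) by (intro arg_cong[where f = ?P])
      (auto simp: max_degree_graph_of_ge_iff vertex_degree_graph_of)
  also have "\<dots> \<le> (\<Sum>v\<in>{1..n}. ?P {b. t \<le> card {e \<in> star n v. b e}})"
    by (intro measure_pmf.finite_measure_subadditive_finite) auto
  also have "\<dots> \<le> (\<Sum>v\<in>{1..n}. 1 / fact t)"
  proof (rule sum_mono)
    fix v assume v: "v \<in> {1..n}"
    have "?P {b. t \<le> card {e \<in> star n v. b e}} \<le> real (card (star n v) choose t) * (1 / n) ^ t"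
      using r assms(1) by (intro prob_card_ge_le finite_vertex_pairs) (auto simp: star_def)
    also have "\<dots> \<le> real (n choose t) * (1 / n) ^ t"
      using card_star_le[OF v] by (intro mult_right_mono of_nat_mono binomial_right_mono) auto
    also have "\<dots> \<le> 1 / fact t"
    proof -
      have "real (n choose t) * fact t \<le> real n ^ t"
        using binomial_fact_pow[of n t] by (metis of_nat_fact of_nat_le_iff of_nat_mult of_nat_power)
      thus ?thesis using assms(1) by (simp add: field_simps)
    qed
    finally show "?P {b. t \<le> card {e \<in> star n v. b e}} \<le> 1 / fact t" .
  qed
  finally show ?thesis by simp
qed

text \<open>Split \<open>2 * s\<close> vertices of \<open>S\<close> into two halves \<open>A\<close> and \<open>B\<close> and count, for each \<open>v \<in> A\<close>, only the
neighbours in \<open>B\<close>. These \<open>s\<close> counts are independent, and each of them reaches \<open>t\<close> with probability at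
least \<open>(s choose t) * q ^ t * (1 - 1 / n) ^ s\<close>, whose last factor is at least one half. All of them
stay below \<open>t\<close> with probability at most \<open>(1 - \<alpha>) ^ s \<le> exp (- s * \<alpha>)\<close> for the resulting
lower bound \<open>\<alpha>\<close>.\<close>
lemma prob_max_degree_less:
  fixes r :: "nat \<times> nat \<Rightarrow> real"
  assumes "1 \<le> n" and r: "\<And>e. e \<in> vertex_pairs n \<Longrightarrow> 0 \<le> r e \<and> r e \<le> 1 / n"
    and S: "S \<subseteq> {1..n}" "2 * s \<le> card S"
    and q: "0 \<le> q" "\<And>i j. i \<in> S \<Longrightarrow> j \<in> S \<Longrightarrow> i < j \<Longrightarrow> q \<le> r (i, j)"
  shows "measure_pmf.prob (Pi_pmf (vertex_pairs n) False (\<lambda>e. bernoulli_pmf (r e)))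
           {b. max_degree (graph_of n b) < t} \<le> exp (- (real s * (real (s choose t) * q ^ t / 2)))"
proof (cases "s = 0")
  case False
  let ?P = "measure_pmf.prob (Pi_pmf (vertex_pairs n) False (\<lambda>e. bernoulli_pmf (r e)))"
  define \<alpha> where "\<alpha> = real (s choose t) * q ^ t / 2"
  obtain A where A: "A \<subseteq> S" "card A = s"
    using S(2) obtain_subset_with_card_n[of s S] by auto
  have fS: "finite S" using S(1) finite_subset by blast
  have "s \<le> card (S - A)"
    using A S(2) fS finite_subset[OF A(1) fS] by (simp add: card_Diff_subset)
  then obtain B where B: "B \<subseteq> S - A" "card B = s"
    using obtain_subset_with_card_n[of s "S - A"] by auto
  have AB: "A \<inter> B = {}" "A \<subseteq> {1..n}" "B \<subseteq> {1..n}" "finite A" "A \<noteq> {}"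
    using A B S fS finite_subset[OF A(1) fS] False by auto
  have sub: "block v B \<subseteq> star n v" if "v \<in> A" for v
    using that AB by (intro block_subset_star) auto
  have sub': "block v B \<subseteq> vertex_pairs n" if "v \<in> A" for v
    using sub[OF that] by (auto simp: star_def)
  have "2 * s \<le> n"
    using S card_mono[of "{1..n}" S] by simp
  have lower: "\<alpha> \<le> ?P {b. t \<le> card {e \<in> block v B. b e}}" if v: "v \<in> A" for v
  proof -
    \<comment> \<open>\<open>B\<close> has at most \<open>n / 2\<close> elements, so Bernoulli's inequality bounds the probability of no
      further edge away from zero.\<close>
    have "1 / 2 \<le> 1 + real s * (- (1 / n))"
      using \<open>2 * s \<le> n\<close> assms(1) by (simp add: field_simps)
    also have "\<dots> \<le> (1 + - (1 / n)) ^ s"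
      using assms(1) by (intro Bernoulli_inequality) auto
    finally have "\<alpha> \<le> real (s choose t) * q ^ t * (1 - 1 / n) ^ s"
      using q(1) unfolding \<alpha>_def
      by (metis (no_types, lifting) mult_left_mono mult_nonneg_nonneg of_nat_0_le_iff times_divide_eq_right
          mult.right_neutral uminus_add_conv_diff add.commute zero_le_power)
    also have "\<dots> = real (card (block v B) choose t) * q ^ t * (1 - 1 / n) ^ card (block v B)"
      using B by (simp add: card_block)
    also have "\<dots> \<le> ?P {b. t \<le> card {e \<in> block v B. b e}}"
    proof (rule prob_card_ge_ge[OF finite_vertex_pairs sub'[OF v]])
      fix e assume e: "e \<in> block v B"
      then obtain j where "j \<in> B" "e = (min v j, max v j)" by (auto simp: block_def)
      moreover have "v \<noteq> j" using \<open>j \<in> B\<close> v AB by auto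
      moreover have "v \<in> S" "j \<in> S" using \<open>j \<in> B\<close> v A B by auto
      ultimately have "q \<le> r e"
        using q(2)[of v j] q(2)[of j v] by (cases "v < j") auto
      with r[of e] e sub'[OF v] show "q \<le> r e \<and> r e \<le> 1 / n" by auto
    qed (use q assms(1) in auto)
    finally show ?thesis .
  qed
  have "?P {b. max_degree (graph_of n b) < t} \<le> ?P {b. \<forall>v\<in>A. card {e \<in> block v B. b e} < t}"
  proof (intro measure_pmf.finite_measure_mono subsetI CollectI ballI)
    fix b v assume b: "b \<in> {b. max_degree (graph_of n b) < t}" and v: "v \<in> A"
    have "card {e \<in> block v B. b e} \<le> card {e \<in> star n v. b e}"
      using sub[OF v] finite_vertex_pairs[of n] by (intro card_mono) (auto simp: star_def)
    also have "\<dots> \<le> max_degree (graph_of n b)"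
      using max_degree_graph_of_ge_iff[OF assms(1), of "card {e \<in> star n v. b e}" b] v AB
      by (auto simp: vertex_degree_graph_of)
    finally show "card {e \<in> block v B. b e} < t" using b by simp
  qed auto
  also have "\<dots> = (\<Prod>v\<in>A. ?P {b. card {e \<in> block v B. b e} < t})"
  proof (rule prob_Pi_pmf_disjoint_blocks[where K = "\<lambda>v. block v B"])
    fix v and b :: "nat \<times> nat \<Rightarrow> bool"
    have "{e \<in> block v B. restrict b (block v B) e} = {e \<in> block v B. b e}" by auto
    thus "(card {e \<in> block v B. restrict b (block v B) e} < t) = (card {e \<in> block v B. b e} < t)"
      by simp
  qed (use AB sub' finite_vertex_pairs disjoint_blocks in auto)
  also have "\<dots> \<le> (\<Prod>v\<in>A. exp (- \<alpha>))"
  proof (intro prod_mono conjI measure_nonneg)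
    fix v assume v: "v \<in> A"
    have "{b. card {e \<in> block v B. b e} < t} = UNIV - {b. t \<le> card {e \<in> block v B. b e}}" by auto
    hence "?P {b. card {e \<in> block v B. b e} < t} = 1 - ?P {b. t \<le> card {e \<in> block v B. b e}}"
      using measure_pmf.prob_compl[of "{b. t \<le> card {e \<in> block v B. b e}}"] by simp
    also have "\<dots> \<le> 1 - \<alpha>" using lower[OF v] by simp
    also have "\<dots> \<le> exp (- \<alpha>)" using exp_ge_add_one_self[of "- \<alpha>"] by simp
    finally show "?P {b. card {e \<in> block v B. b e} < t} \<le> exp (- \<alpha>)" .
  qed
  also have "\<dots> = exp (- (real s * \<alpha>))"
    using A by (simp add: exp_of_nat_mult[symmetric])
  finally show ?thesis by (simp add: \<alpha>_def)
qed auto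

section \<open>Random weights\<close>

text \<open>Exponential Markov inequality: \<open>(1 / 2) ^ K\<close>, where \<open>K\<close> is the number of coordinates in \<open>J\<close>, is a
product of independent factors of mean \<open>1 - measure N J / 2\<close>.\<close>
lemma prob_few_coordinates_in_set:
  assumes "prob_space N" "finite I" and J: "J \<in> sets N"
  shows "measure (\<Pi>\<^sub>M i\<in>I. N) {w \<in> space (\<Pi>\<^sub>M i\<in>I. N). card {i \<in> I. w i \<in> J} < s}
           \<le> 2 ^ s * (1 - measure N J / 2) ^ card I"
proof -
  interpret N: prob_space N by fact
  interpret product_prob_space "\<lambda>_. N" I by unfold_locales
  let ?M = "\<Pi>\<^sub>M i\<in>I. N"
  define u where "u = (\<lambda>w. \<Prod>i\<in>I. 1 - indicator J (w i) / 2 :: real)"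
  have int: "integrable N (\<lambda>y. 1 - indicator J y / 2 :: real)"
    using J by (intro Bochner_Integration.integrable_diff integrable_divide_zero) (auto simp: N.emeasure_eq_measure)
  have u: "u w = (1 / 2) ^ card {i \<in> I. w i \<in> J}" for w
  proof -
    have "u w = (\<Prod>i\<in>I. if w i \<in> J then 1 / 2 else 1)"
      unfolding u_def by (intro prod.cong) auto
    also have "\<dots> = (1 / 2) ^ card {i \<in> I. w i \<in> J}"
      using assms(2) by (simp add: prod.If_cases Int_def)
    finally show ?thesis .
  qed
  have "{w \<in> space ?M. card {i \<in> I. w i \<in> J} < s} \<subseteq> {w \<in> space ?M. (1 / 2) ^ s \<le> u w}"
    by (auto simp: u intro!: power_decreasing)
  moreover have [measurable]: "u \<in> borel_measurable ?M"
    unfolding u_def using J by measurable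
  ultimately have "measure ?M {w \<in> space ?M. card {i \<in> I. w i \<in> J} < s}
      \<le> measure ?M {w \<in> space ?M. (1 / 2) ^ s \<le> u w}"
    by (intro P.finite_measure_mono) (assumption, measurable)
  also have "\<dots> \<le> (\<integral>w. u w \<partial>?M) / (1 / 2) ^ s"
  proof (rule integral_Markov_inequality_measure[where A = "{}"])
    show "integrable ?M u"
      unfolding u_def by (rule product_integrable_prod[OF assms(2)]) (rule int)
    show "AE w in ?M. 0 \<le> u w" by (simp add: u)
  qed auto
  also have "(\<integral>w. u w \<partial>?M) = (1 - measure N J / 2) ^ card I"
  proof -
    have "(\<integral>y. 1 - indicator J y / 2 \<partial>N) = 1 - measure N J / 2"
      using J by (subst Bochner_Integration.integral_diff)
        (auto simp: N.prob_space N.emeasure_eq_measure intro!: integrable_divide_zero)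
    thus ?thesis
      unfolding u_def by (subst product_integral_prod[OF assms(2)]) (use int in auto)
  qed
  finally show ?thesis by (simp add: field_simps power_divide)
qed

lemma prob_space_unif01: "prob_space unif01"
  unfolding unif01_def by (rule prob_spaceI) (simp add: emeasure_restrict_space)

lemma measure_unif01:
  assumes "0 \<le> a" "a \<le> b" "b \<le> 1"
  shows "{a<..<b} \<in> sets unif01" "measure unif01 {a<..<b} = b - a"
proof -
  have "{a<..<b} \<subseteq> {0<..<1}" using assms by auto
  thus "{a<..<b} \<in> sets unif01" "measure unif01 {a<..<b} = b - a"
    using assms unfolding unif01_def
    by (auto simp: sets_restrict_space_iff measure_restrict_space)
qed

section \<open>Mixing over the weights\<close>

locale edge_kernel =
  fixes \<kappa> :: "real \<times> real \<Rightarrow> real"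
  assumes kernel_measurable: "\<kappa> \<in> borel_measurable (restrict_space borel ({0..1} \<times> {0..1}))"
    and kernel_range: "\<And>x y. x \<in> {0..1} \<Longrightarrow> y \<in> {0..1} \<Longrightarrow> \<kappa> (x, y) \<in> {0..1}"
begin

abbreviation weights :: "nat \<Rightarrow> (nat \<Rightarrow> real) measure" where
  "weights n \<equiv> (\<Pi>\<^sub>M i\<in>{1..n}. unif01)"

lemma weights_in_unit_interval:
  assumes "w \<in> space (weights n)" "i \<in> {1..n}"
  shows "w i \<in> {0..1}"
proof -
  have "w i \<in> space unif01"
    using assms unfolding space_PiM by (rule PiE_mem)
  thus ?thesis by (simp add: unif01_def space_restrict_space)
qed

lemma measurable_kernel_weights:
  assumes "i \<in> {1..n}" "j \<in> {1..n}"
  shows "(\<lambda>w. \<kappa> (w i, w j)) \<in> borel_measurable (weights n)"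
proof (rule measurable_compose[OF _ kernel_measurable], rule measurable_restrict_space2)
  have id: "(\<lambda>x. x) \<in> borel_measurable unif01"
    unfolding unif01_def by (intro measurable_restrict_space1) simp
  have "(\<lambda>w. w i) \<in> borel_measurable (weights n)" if "i \<in> {1..n}" for i
    by (rule measurable_compose[OF measurable_component_singleton[OF that] id])
  thus "(\<lambda>w. (w i, w j)) \<in> borel_measurable (weights n)"
    using assms by (intro borel_measurable_Pair) auto
  show "(\<lambda>w. (w i, w j)) \<in> space (weights n) \<rightarrow> {0..1} \<times> {0..1}"
    using assms by (intro funcsetI SigmaI weights_in_unit_interval)
qed

lemma measurable_graph_of: "graph_of n \<in> measure_pmf p \<rightarrow>\<^sub>M count_space (simple_graphs n)"
  by (auto simp: measurable_def graph_of_in_simple_graphs)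

lemma emeasure_conditional_law:
  assumes "X \<subseteq> simple_graphs n"
  shows "emeasure (conditional_law n \<kappa> w) X = ennreal (measure_pmf.prob
     (Pi_pmf (vertex_pairs n) False (\<lambda>(i, j). bernoulli_pmf (\<kappa> (w i, w j)))) {b. graph_of n b \<in> X})"
  unfolding conditional_law_def using assms
  by (subst emeasure_distr[OF measurable_graph_of]) (auto simp: measure_pmf.emeasure_eq_measure vimage_def)

text \<open>Measurability in the weights is what makes the monadic bind the mixture of the conditional laws. The probability of a set of graphs is a finite sum, over the edge
configurations \<open>b\<close>, of products of the numbers \<open>\<kappa> (w i, w j)\<close> and \<open>1 - \<kappa> (w i, w j)\<close>.\<close>
lemma measurable_conditional_law:
  "conditional_law n \<kappa> \<in> weights n \<rightarrow>\<^sub>M subprob_algebra (count_space (simple_graphs n))"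
proof (rule measurable_subprob_algebra)
  fix w
  have "prob_space (conditional_law n \<kappa> w)"
    unfolding conditional_law_def
    by (intro measure_pmf.prob_space_distr measurable_graph_of)
  thus "subprob_space (conditional_law n \<kappa> w)" by (rule prob_space_imp_subprob_space)
  show "sets (conditional_law n \<kappa> w) = sets (count_space (simple_graphs n))"
    by (simp add: conditional_law_def)
next
  fix X assume "X \<in> sets (count_space (simple_graphs n))"
  hence X: "X \<subseteq> simple_graphs n" by simp
  let ?D = "vertex_pairs n"
  let ?p = "\<lambda>w. Pi_pmf ?D False (\<lambda>(i, j). bernoulli_pmf (\<kappa> (w i, w j)))"
  have fin: "finite ?D" by (rule finite_vertex_pairs)
  \<comment> \<open>Configurations are false outside \<open>?D\<close> almost surely, which leaves finitely many.\<close>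
  define F where "F = PiE_dflt ?D False (\<lambda>_. UNIV :: bool set) \<inter> {b. graph_of n b \<in> X}"
  have finF: "finite F" unfolding F_def using fin by (intro finite_Int disjI1 finite_PiE_dflt) auto
  have "emeasure (conditional_law n \<kappa> w) X =
     ennreal (\<Sum>b\<in>F. \<Prod>(i, j)\<in>?D. if b (i, j) then \<kappa> (w i, w j) else 1 - \<kappa> (w i, w j))"
    if w: "w \<in> space (weights n)" for w
  proof -
    have "measure_pmf.prob (?p w) {b. graph_of n b \<in> X} = measure_pmf.prob (?p w) F"
      using set_Pi_pmf_subset[OF fin, of False "\<lambda>(i, j). bernoulli_pmf (\<kappa> (w i, w j))"]
      by (intro measure_prob_cong_0) (auto simp: F_def PiE_dflt_def set_pmf_eq)
    also have "\<dots> = (\<Sum>b\<in>F. pmf (?p w) b)"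
      by (rule measure_measure_pmf_finite[OF finF])
    also have "\<dots> = (\<Sum>b\<in>F. \<Prod>(i, j)\<in>?D. if b (i, j) then \<kappa> (w i, w j) else 1 - \<kappa> (w i, w j))"
    proof (rule sum.cong)
      fix b assume "b \<in> F"
      hence "pmf (?p w) b = (\<Prod>e\<in>?D. pmf (case e of (i, j) \<Rightarrow> bernoulli_pmf (\<kappa> (w i, w j))) (b e))"
        using fin by (intro pmf_Pi') (auto simp: F_def PiE_dflt_def)
      also have "\<dots> = (\<Prod>(i, j)\<in>?D. if b (i, j) then \<kappa> (w i, w j) else 1 - \<kappa> (w i, w j))"
      proof (rule prod.cong)
        fix e assume "e \<in> ?D"
        then obtain i j where e: "e = (i, j)" "i \<in> {1..n}" "j \<in> {1..n}"
          by (auto simp: vertex_pairs_def)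
        hence "\<kappa> (w i, w j) \<in> {0..1}" using w weights_in_unit_interval kernel_range by blast
        thus "pmf (case e of (i, j) \<Rightarrow> bernoulli_pmf (\<kappa> (w i, w j))) (b e) =
            (case e of (i, j) \<Rightarrow> if b (i, j) then \<kappa> (w i, w j) else 1 - \<kappa> (w i, w j))"
          by (cases "b (i, j)") (auto simp: e(1))
      qed simp
      finally show "pmf (?p w) b = \<dots>" .
    qed simp
    finally show ?thesis using emeasure_conditional_law[OF X] by simp
  qed
  moreover have "(\<lambda>w. ennreal (\<Sum>b\<in>F. \<Prod>(i, j)\<in>?D. if b (i, j) then \<kappa> (w i, w j) else 1 - \<kappa> (w i, w j)))
      \<in> borel_measurable (weights n)"
  proof (rule measurable_compose[OF _ measurable_ennreal], intro borel_measurable_sum borel_measurable_prod)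
    fix b e assume "e \<in> ?D"
    then obtain i j where e: "e = (i, j)" "i \<in> {1..n}" "j \<in> {1..n}"
      by (auto simp: vertex_pairs_def)
    note [measurable] = measurable_kernel_weights[OF e(2,3)]
    show "(\<lambda>w. case e of (i, j) \<Rightarrow> if b (i, j) then \<kappa> (w i, w j) else 1 - \<kappa> (w i, w j))
      \<in> borel_measurable (weights n)"
      unfolding e(1) prod.case by measurable
  qed
  ultimately show "(\<lambda>w. emeasure (conditional_law n \<kappa> w) X) \<in> borel_measurable (weights n)"
    by (subst measurable_cong) auto
qed

text \<open>Transfers a bound that holds for fixed weights to the random graph, at the cost of the probability
of an exceptional set \<open>G\<close> of weights.\<close>
lemma measure_inhomogeneous_random_graph_le:
  assumes X: "X \<subseteq> simple_graphs n" and G: "G \<in> sets (weights n)" and "0 \<le> \<delta>"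
    and bound: "\<And>w. w \<in> space (weights n) \<Longrightarrow> w \<notin> G \<Longrightarrow>
      measure_pmf.prob (Pi_pmf (vertex_pairs n) False (\<lambda>(i, j). bernoulli_pmf (\<kappa> (w i, w j))))
        {b. graph_of n b \<in> X} \<le> \<delta>"
  shows "measure (inhomogeneous_random_graph n \<kappa>) X \<le> \<delta> + measure (weights n) G"
proof -
  interpret W: prob_space "weights n" by (intro prob_space_PiM prob_space_unif01)
  have "emeasure (inhomogeneous_random_graph n \<kappa>) X
      = (\<integral>\<^sup>+w. emeasure (conditional_law n \<kappa> w) X \<partial>weights n)"
    unfolding inhomogeneous_random_graph_def
    using X by (intro emeasure_bind[OF W.not_empty measurable_conditional_law]) simp
  also have "\<dots> \<le> (\<integral>\<^sup>+w. ennreal \<delta> + indicator G w \<partial>weights n)"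
  proof (rule nn_integral_mono)
    fix w assume w: "w \<in> space (weights n)"
    show "emeasure (conditional_law n \<kappa> w) X \<le> ennreal \<delta> + indicator G w"
    proof (cases "w \<in> G")
      case False
      thus ?thesis using bound[OF w] by (simp add: emeasure_conditional_law[OF X] ennreal_leI)
    next
      case True
      have "emeasure (conditional_law n \<kappa> w) X \<le> 1"
        by (simp add: emeasure_conditional_law[OF X])
      thus ?thesis using True by (simp add: add_increasing)
    qed
  qed
  also have "\<dots> = ennreal (\<delta> + measure (weights n) G)"
    using G assms(3)
    unfolding ennreal_plus[OF assms(3) measure_nonneg] W.emeasure_eq_measure[symmetric]
    by (subst nn_integral_add) (simp_all add: W.emeasure_space_1 del: One_nat_def)
  finally show ?thesis
    unfolding measure_def[of "inhomogeneous_random_graph n \<kappa>"]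
    using assms(3) by (simp add: enn2real_leI)
qed

lemma sets_few_weights:
  assumes "J \<in> sets unif01"
  shows "{w \<in> space (weights n). card {i \<in> {1..n}. w i \<in> J} < s} \<in> sets (weights n)"
proof -
  note [measurable] = assms
  have "card {i \<in> {1..n}. w i \<in> J} < s \<longleftrightarrow> (\<Sum>i\<in>{1..n}. indicator J (w i) :: real) < real s" for w
  proof -
    have "(\<Sum>i\<in>{1..n}. indicator J (w i) :: real) = real (card {i \<in> {1..n}. w i \<in> J})"
      by (simp add: indicator_def sum.If_cases Int_def)
    thus ?thesis by simp
  qed
  moreover have "{w \<in> space (weights n). (\<Sum>i\<in>{1..n}. indicator J (w i) :: real) < real s} \<in> sets (weights n)"
    by measurable
  ultimately show ?thesis by simp
qed

context
  fixes n :: nat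
  assumes n: "1 \<le> n"
    and le: "\<And>x y. x \<in> {0..1} \<Longrightarrow> y \<in> {0..1} \<Longrightarrow> \<kappa> (x, y) \<le> 1 / n"
begin

lemma edge_probability:
  assumes "w \<in> space (weights n)" "e \<in> vertex_pairs n"
  shows "0 \<le> (case e of (i, j) \<Rightarrow> \<kappa> (w i, w j)) \<and> (case e of (i, j) \<Rightarrow> \<kappa> (w i, w j)) \<le> 1 / n"
proof -
  obtain i j where e: "e = (i, j)" "i \<in> {1..n}" "j \<in> {1..n}"
    using assms(2) by (auto simp: vertex_pairs_def)
  note ij = weights_in_unit_interval[OF assms(1) e(2)] weights_in_unit_interval[OF assms(1) e(3)]
  show ?thesis using kernel_range[OF ij] le[OF ij] by (simp add: e(1))
qed

text \<open>Brings the conditional law into the form in which the edge probabilities are one function on pairs.\<close>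
lemma conditional_edges:
  "(\<lambda>(i, j). bernoulli_pmf (\<kappa> (w i, w j))) = (\<lambda>e. bernoulli_pmf (case e of (i, j) \<Rightarrow> \<kappa> (w i, w j)))"
  by (simp add: fun_eq_iff)

lemma measure_max_degree_ge:
  "measure (inhomogeneous_random_graph n \<kappa>) {G \<in> simple_graphs n. t \<le> max_degree G} \<le> n / fact t"
proof -
  have "measure (inhomogeneous_random_graph n \<kappa>) {G \<in> simple_graphs n. t \<le> max_degree G}
          \<le> n / fact t + measure (weights n) {}"
  proof (rule measure_inhomogeneous_random_graph_le)
    fix w assume w: "w \<in> space (weights n)"
    show "measure_pmf.prob (Pi_pmf (vertex_pairs n) False (\<lambda>(i, j). bernoulli_pmf (\<kappa> (w i, w j))))
        {b. graph_of n b \<in> {G \<in> simple_graphs n. t \<le> max_degree G}} \<le> n / fact t"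
      unfolding conditional_edges
      using prob_max_degree_ge[OF n edge_probability[OF w]]
      by (simp add: graph_of_in_simple_graphs)
  qed auto
  thus ?thesis by simp
qed

text \<open>The exceptional weights are those with fewer than \<open>2 * s\<close> vertices in \<open>J\<close>; otherwise the
vertices with weight in \<open>J\<close> serve as the set \<open>S\<close> of the bound for independent edges.\<close>
lemma measure_max_degree_less:
  assumes J: "J \<in> sets unif01" and q: "0 \<le> q" "\<And>x y. x \<in> J \<Longrightarrow> y \<in> J \<Longrightarrow> q \<le> \<kappa> (x, y)"
  shows "measure (inhomogeneous_random_graph n \<kappa>) {G \<in> simple_graphs n. max_degree G < t}
    \<le> exp (- (real s * (real (s choose t) * q ^ t / 2)))
      + 2 ^ (2 * s) * (1 - measure unif01 J / 2) ^ n"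
proof -
  let ?F = "{w \<in> space (weights n). card {i \<in> {1..n}. w i \<in> J} < 2 * s}"
  have "measure (inhomogeneous_random_graph n \<kappa>) {G \<in> simple_graphs n. max_degree G < t}
          \<le> exp (- (real s * (real (s choose t) * q ^ t / 2))) + measure (weights n) ?F"
  proof (rule measure_inhomogeneous_random_graph_le[OF _ sets_few_weights[OF J]])
    fix w assume w: "w \<in> space (weights n)" "w \<notin> ?F"
    let ?P = "measure_pmf.prob (Pi_pmf (vertex_pairs n) False
      (\<lambda>e. bernoulli_pmf (case e of (i, j) \<Rightarrow> \<kappa> (w i, w j))))"
    have "?P {b. max_degree (graph_of n b) < t} \<le> exp (- (real s * (real (s choose t) * q ^ t / 2)))"
      by (rule prob_max_degree_less[OF n edge_probability[OF w(1)], where S = "{i \<in> {1..n}. w i \<in> J}"])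
        (use w q in auto)
    thus "measure_pmf.prob (Pi_pmf (vertex_pairs n) False (\<lambda>(i, j). bernoulli_pmf (\<kappa> (w i, w j))))
        {b. graph_of n b \<in> {G \<in> simple_graphs n. max_degree G < t}}
        \<le> exp (- (real s * (real (s choose t) * q ^ t / 2)))"
      unfolding conditional_edges by (simp add: graph_of_in_simple_graphs)
  qed auto
  also have "measure (weights n) ?F \<le> 2 ^ (2 * s) * (1 - measure unif01 J / 2) ^ n"
    using prob_few_coordinates_in_set[OF prob_space_unif01 finite_atLeastAtMost J, of 1 n "2 * s"] by simp
  finally show ?thesis by simp
qed

end

end

section \<open>Asymptotics of the error terms\<close>

lemma power_self_le_exp_fact: "real t ^ t \<le> exp (real t) * fact t"
proof -
  have "real t ^ t / fact t \<le> (\<Sum>k. real t ^ k / fact k)"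
    using sum_le_suminf[of "\<lambda>k. real t ^ k / fact k" "{t}"] summable_exp[of "real t"]
    by (simp add: divide_inverse mult.commute)
  also have "\<dots> = exp (real t)"
    by (simp add: exp_def divide_inverse mult.commute)
  finally show ?thesis by (simp add: field_simps)
qed

text \<open>Since \<open>t ^ t / fact t\<close> is a term of the exponential series at \<open>t\<close>, \<open>fact t\<close> is at least
\<open>(t / e) ^ t = exp (t * (ln t - 1))\<close>. Passing to a real lower bound \<open>x\<close> of \<open>t\<close> removes the rounding
before the asymptotic analysis; the exponent increases on \<open>x \<ge> e\<close>.\<close>
lemma exp_le_fact:
  assumes "exp 1 \<le> x" "x \<le> real t"
  shows "exp (x * (ln x - 1)) \<le> fact t"
proof -
  have "0 < x" using assms(1) exp_gt_zero[of "1::real"] by linarith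
  moreover from this have "1 \<le> ln x" using assms(1) by (simp add: ln_ge_iff)
  ultimately have x: "0 < x" "1 \<le> ln x" by auto
  hence t: "0 < real t" "ln x \<le> ln (real t)" using assms(2) by (auto simp: ln_mono)
  have "exp (x * (ln x - 1)) \<le> exp (real t * (ln (real t) - 1))"
    using x t assms(2) by (simp add: mult_mono)
  also have "\<dots> = real t ^ t / exp (real t)"
    using t by (simp add: right_diff_distrib exp_diff exp_of_nat_mult)
  also have "\<dots> \<le> fact t"
    using power_self_le_exp_fact[of t] by (simp add: field_simps)
  finally show ?thesis .
qed

text \<open>With \<open>x = (1 + \<epsilon>) * ln n / ln (ln n)\<close>, \<open>x * ln x\<close> is asymptotic to \<open>(1 + \<epsilon>) * ln n\<close>, so
\<open>fact t\<close> exceeds \<open>n\<close> by a factor \<open>n powr (\<epsilon> - o(1))\<close>.\<close>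
lemma tendsto_n_over_fact:
  fixes \<epsilon> :: real
  assumes "0 < \<epsilon>"
  shows "(\<lambda>n. real n / fact (nat \<lceil>(1 + \<epsilon>) * (ln (real n) / ln (ln (real n)))\<rceil>)) \<longlonglongrightarrow> 0"
proof -
  define x where "x = (\<lambda>n::nat. (1 + \<epsilon>) * (ln (real n) / ln (ln (real n))))"
  have "filterlim x at_top sequentially" unfolding x_def using assms by real_asymp
  hence ev: "eventually (\<lambda>n. exp 1 \<le> x n) sequentially"
    by (simp add: filterlim_at_top)
  have lim: "(\<lambda>n. real n * exp (- (x n * (ln (x n) - 1)))) \<longlonglongrightarrow> 0"
    unfolding x_def using assms by real_asymp
  have "(\<lambda>n. real n / fact (nat \<lceil>x n\<rceil>)) \<longlonglongrightarrow> 0"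
  proof (rule tendsto_sandwich[OF _ _ tendsto_const lim])
    show "\<forall>\<^sub>F n in sequentially. real n / fact (nat \<lceil>x n\<rceil>) \<le> real n * exp (- (x n * (ln (x n) - 1)))"
      using ev
    proof eventually_elim
      case (elim n)
      have "exp (x n * (ln (x n) - 1)) \<le> fact (nat \<lceil>x n\<rceil>)"
        using elim by (intro exp_le_fact) linarith+
      hence "real n / fact (nat \<lceil>x n\<rceil>) \<le> real n / exp (x n * (ln (x n) - 1))"
        by (intro divide_left_mono) auto
      thus ?case by (simp add: exp_minus divide_inverse)
    qed
  qed simp
  thus ?thesis unfolding x_def .
qed

text \<open>The exponent is, up to sign, a lower bound for the mean number of vertices of degree at least \<open>t\<close>. With \<open>s\<close> proportional to \<open>n\<close> and \<open>(s choose t) \<ge> (s / t) ^ t\<close> it is at least a constant times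
\<open>n * (\<beta> / t) ^ t\<close>, and \<open>t * ln (t / \<beta>)\<close> is asymptotic to \<open>(1 - \<epsilon>) * ln n\<close>. Hence it is at least
\<open>n powr (\<epsilon> - o(1))\<close>.\<close>
lemma tendsto_exp_binomial:
  fixes \<epsilon> \<alpha> q :: real
  assumes \<epsilon>: "0 < \<epsilon>" "\<epsilon> < 1" and "0 < \<alpha>" "0 < q"
  defines "t \<equiv> \<lambda>n::nat. nat \<lceil>(1 - \<epsilon>) * (ln (real n) / ln (ln (real n)))\<rceil>"
  defines "s \<equiv> \<lambda>n::nat. nat \<lfloor>\<alpha> * real n\<rfloor>"
  shows "(\<lambda>n. exp (- (real (s n) * (real (s n choose t n) * (q / real n) ^ t n / 2)))) \<longlonglongrightarrow> 0"
proof -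
  \<comment> \<open>The summand 1 makes \<open>x n\<close> an upper bound of the rounded \<open>t n\<close>; the factor 1/2 in \<open>\<beta>\<close> absorbs
    the rounding of \<open>s n\<close>.\<close>
  define x where "x = (\<lambda>n::nat. (1 - \<epsilon>) * (ln (real n) / ln (ln (real n))) + 1)"
  define \<beta> where "\<beta> = \<alpha> * q / 2"
  have \<beta>: "0 < \<beta>" unfolding \<beta>_def using assms by simp
  have "filterlim x at_top sequentially" unfolding x_def using \<epsilon> by real_asymp
  hence ev1: "eventually (\<lambda>n. max 2 \<beta> \<le> x n) sequentially"
    unfolding filterlim_at_top by blast
  have ev2: "eventually (\<lambda>n. x n \<le> \<alpha> * real n / 2) sequentially"
    unfolding x_def using assms by real_asymp
  have lim: "filterlim (\<lambda>n. \<alpha> * real n / 4 * exp (- (x n * ln (x n / \<beta>)))) at_top sequentially"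
    unfolding x_def using assms \<beta> by real_asymp
  have "eventually (\<lambda>n. \<alpha> * real n / 4 * exp (- (x n * ln (x n / \<beta>)))
          \<le> real (s n) * (real (s n choose t n) * (q / real n) ^ t n / 2)) sequentially"
    using ev1 ev2
  proof eventually_elim
    case (elim n)
    have t: "1 \<le> t n" "real (t n) \<le> x n"
      using elim(1) unfolding t_def x_def by linarith+
    have n: "0 < n" using elim \<open>0 < \<alpha>\<close> by (cases n) auto
    have s: "\<alpha> * real n / 2 \<le> real (s n)"
      using elim unfolding s_def by linarith
    have "t n \<le> s n" using t s elim by linarith
    have "exp (- (x n * ln (x n / \<beta>))) \<le> exp (- (real (t n) * ln (real (t n) / \<beta>)))"
    proof -
      have "ln (real (t n) / \<beta>) \<le> ln (x n / \<beta>)"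
        using t \<beta> by (intro ln_mono divide_right_mono) auto
      hence "real (t n) * ln (real (t n) / \<beta>) \<le> real (t n) * ln (x n / \<beta>)"
        by (intro mult_left_mono) auto
      also have "\<dots> \<le> x n * ln (x n / \<beta>)"
        using t elim(1) \<beta> by (intro mult_right_mono ln_ge_zero) auto
      finally show ?thesis by simp
    qed
    also have "\<dots> = (\<beta> / real (t n)) ^ t n"
    proof -
      have "- (real (t n) * ln (real (t n) / \<beta>)) = real (t n) * ln (\<beta> / real (t n))"
        using t \<beta> by (simp add: ln_div algebra_simps)
      thus ?thesis using t \<beta> by (simp add: exp_of_nat_mult)
    qed
    also have "\<dots> \<le> (real (s n) / real (t n) * (q / real n)) ^ t n"
    proof (rule power_mono)
      have "\<beta> \<le> real (s n) * q / real n"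
        using s n \<open>0 < q\<close> by (simp add: \<beta>_def field_simps)
      thus "\<beta> / real (t n) \<le> real (s n) / real (t n) * (q / real n)"
        using t divide_right_mono[of \<beta> "real (s n) * q / real n" "real (t n)"] by (simp add: mult.commute)
    qed (use \<beta> in auto)
    also have "\<dots> = (real (s n) / real (t n)) ^ t n * (q / real n) ^ t n"
      by (rule power_mult_distrib)
    also have "\<dots> \<le> real (s n choose t n) * (q / real n) ^ t n"
      using \<open>t n \<le> s n\<close> \<open>0 < q\<close> by (intro mult_right_mono binomial_ge_n_over_k_pow_k) auto
    finally have "(\<alpha> * real n / 2) * (exp (- (x n * ln (x n / \<beta>))) / 2)
        \<le> real (s n) * (real (s n choose t n) * (q / real n) ^ t n / 2)"
      using s \<open>0 < \<alpha>\<close> by (intro mult_mono) auto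
    thus ?case by simp
  qed
  from filterlim_at_top_mono[OF lim this] show ?thesis
    by (intro filterlim_compose[OF exp_at_bot]) (simp add: filterlim_uminus_at_top[symmetric])
qed

text \<open>On average \<open>p * n\<close> weights lie in a set of measure \<open>p\<close>. Asking for a quarter of them leaves room
for the exponential Markov bound: \<open>2 ^ (2 * s) \<le> exp (p * n / 4)\<close>, while the mean factor is at most
\<open>exp (- p * n / 2)\<close>.\<close>
lemma tendsto_few_weights:
  fixes p :: real
  assumes "0 < p" "p \<le> 1"
  defines "s \<equiv> \<lambda>n::nat. nat \<lfloor>p / 8 * real n\<rfloor>"
  shows "(\<lambda>n. 2 ^ (2 * s n) * (1 - p / 2) ^ n) \<longlonglongrightarrow> 0"
proof (rule tendsto_sandwich[OF _ _ tendsto_const])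
  show "(\<lambda>n. exp (- (p / 4) * real n)) \<longlonglongrightarrow> 0" using assms by real_asymp
  show "\<forall>\<^sub>F n in sequentially. 2 ^ (2 * s n) * (1 - p / 2) ^ n \<le> exp (- (p / 4) * real n)"
  proof (rule always_eventually, rule allI)
    fix n
    have "(2::real) \<le> exp 1" using exp_ge_add_one_self[of "1::real"] by simp
    hence "(2::real) ^ (2 * s n) \<le> exp 1 ^ (2 * s n)" by (intro power_mono) auto
    also have "\<dots> = exp (2 * real (s n))" by (simp add: exp_of_nat_mult[symmetric])
    also have "2 * real (s n) \<le> p / 4 * real n"
    proof -
      have "real (s n) \<le> p / 8 * real n" unfolding s_def using assms by (intro of_nat_floor) simp
      thus ?thesis by linarith
    qed
    finally have 1: "(2::real) ^ (2 * s n) \<le> exp (p / 4 * real n)" by simp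
    have "(1 - p / 2) ^ n \<le> exp (- (p / 2)) ^ n"
      using assms exp_ge_add_one_self[of "- (p / 2)"] by (intro power_mono) auto
    also have "\<dots> = exp (- (p / 2) * real n)" by (simp add: exp_of_nat_mult[symmetric] mult.commute)
    finally have "2 ^ (2 * s n) * (1 - p / 2) ^ n \<le> exp (p / 4 * real n) * exp (- (p / 2) * real n)"
      using 1 assms by (intro mult_mono) auto
    also have "\<dots> = exp (- (p / 4) * real n)" by (simp add: exp_add[symmetric] field_simps)
    finally show "2 ^ (2 * s n) * (1 - p / 2) ^ n \<le> exp (- (p / 4) * real n)" .
  qed
  show "\<forall>\<^sub>F n in sequentially. 0 \<le> 2 ^ (2 * s n) * (1 - p / 2) ^ n" using assms by simp
qed

section \<open>Concentration of the maximum degree\<close>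

text \<open>The point \<open>m\<close> may be an endpoint of the unit interval, so the interval \<open>(m - d / 2, m + d / 2)\<close> is cut off
at 0 and 1; what remains has positive length.\<close>
lemma continuous_positive_interval:
  fixes k :: "real \<times> real \<Rightarrow> real"
  assumes cont: "continuous (at (m, m) within {0..1} \<times> {0..1}) k"
    and m: "m \<in> {0..1}" and pos: "0 < k (m, m)"
  obtains a b where "0 \<le> a" "a < b" "b \<le> 1"
    "\<And>x y. x \<in> {a<..<b} \<Longrightarrow> y \<in> {a<..<b} \<Longrightarrow> k (m, m) / 2 \<le> k (x, y)"
proof -
  obtain d where d: "0 < d"
    "\<And>z. z \<in> {0..1} \<times> {0..1} \<Longrightarrow> dist z (m, m) < d \<Longrightarrow> dist (k z) (k (m, m)) < k (m, m) / 2"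
    using cont pos unfolding continuous_within_eps_delta by (metis half_gt_zero)
  define a b where "a = max 0 (m - d / 2)" and "b = min 1 (m + d / 2)"
  show thesis
  proof (rule that[of a b])
    show "0 \<le> a" "a < b" "b \<le> 1" using m d(1) by (auto simp: a_def b_def)
    fix x y assume xy: "x \<in> {a<..<b}" "y \<in> {a<..<b}"
    hence "m - d / 2 < x" "x < m + d / 2" "m - d / 2 < y" "y < m + d / 2"
      and square: "(x, y) \<in> {0..1} \<times> {0..1}"
      by (auto simp: a_def b_def)
    hence "\<bar>x - m\<bar> < d / 2" "\<bar>y - m\<bar> < d / 2"
      unfolding abs_less_iff by linarith+
    moreover have "dist (x, y) (m, m) \<le> \<bar>x - m\<bar> + \<bar>y - m\<bar>"
      by (simp add: dist_Pair_Pair dist_real_def sqrt_sum_squares_le_sum_abs[of "x - m" "y - m", simplified])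
    ultimately have "dist (k (x, y)) (k (m, m)) < k (m, m) / 2"
      by (intro d(2)[OF square]) linarith
    thus "k (m, m) / 2 \<le> k (x, y)" unfolding dist_real_def by linarith
  qed
qed

theorem theorem1p1:
  fixes k :: "real \<times> real \<Rightarrow> real"
    and m c \<epsilon> :: real
    and \<Omega> :: "nat \<Rightarrow> 'a measure"
    and I :: "nat \<Rightarrow> 'a \<Rightarrow> graph"
  assumes k_range: "\<And>x y. x \<in> {0..1} \<Longrightarrow> y \<in> {0..1} \<Longrightarrow> k (x, y) \<in> {0..1}"
    and k_pos: "\<And>x y. x \<in> {0..1} \<Longrightarrow> y \<in> {0..1} \<Longrightarrow> 0 < k (x, y)"
    and k_sym: "\<And>x y. x \<in> {0..1} \<Longrightarrow> y \<in> {0..1} \<Longrightarrow> k (x, y) = k (y, x)"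
    and k_meas: "k \<in> borel_measurable (restrict_space borel ({0..1} \<times> {0..1}))"
    and m: "m \<in> {0..1}"
    and k_max: "\<And>x y. x \<in> {0..1} \<Longrightarrow> y \<in> {0..1} \<Longrightarrow> k (x, y) \<le> k (m, m)"
    and k_cont: "continuous (at (m, m) within {0..1} \<times> {0..1}) k"
    and c: "0 < c" "k (m, m) < c"
    and \<Omega>: "\<And>n. 1 \<le> n \<Longrightarrow> prob_space (\<Omega> n)"
    and I: "\<And>n. 1 \<le> n \<Longrightarrow> I n \<in> \<Omega> n \<rightarrow>\<^sub>M count_space (simple_graphs n)"
    and I_law: "\<And>n. 1 \<le> n \<Longrightarrow>
      distr (\<Omega> n) (count_space (simple_graphs n)) (I n)
        = inhomogeneous_random_graph n (\<lambda>z. k z / (c * real n))"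
    and \<epsilon>: "0 < \<epsilon>"
  defines "\<Delta> \<equiv> \<lambda>n::nat. ln (real n) / ln (ln (real n))"
  shows "(\<lambda>n. \<P>(\<omega> in \<Omega> n.
            real (max_degree (I n \<omega>)) \<in> {(1 - \<epsilon>) * \<Delta> n .. (1 + \<epsilon>) * \<Delta> n}))
         \<longlonglongrightarrow> 1"
proof -
  obtain a b where ab: "0 \<le> a" "a < b" "b \<le> 1"
    and k_lower: "\<And>x y. x \<in> {a<..<b} \<Longrightarrow> y \<in> {a<..<b} \<Longrightarrow> k (m, m) / 2 \<le> k (x, y)"
    using continuous_positive_interval[OF k_cont m k_pos[OF m m]] by blast
  define p where "p = b - a"
  have p: "0 < p" "p \<le> 1" using ab by (auto simp: p_def)
  have J: "{a<..<b} \<in> sets unif01" "measure unif01 {a<..<b} = p"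
    using measure_unif01[of a b] ab by (auto simp: p_def)
  define q where "q = k (m, m) / (2 * c)"
  have q: "0 < q" unfolding q_def using k_pos[OF m m] c by simp
  \<comment> \<open>For \<open>\<epsilon> \<ge> 1\<close> the lower end of the window is not positive for large \<open>n\<close>; a smaller \<open>\<eta>\<close> gives a
    stronger lower bound to which the estimates apply.\<close>
  define \<eta> where "\<eta> = min \<epsilon> (1 / 2)"
  have \<eta>: "0 < \<eta>" "\<eta> < 1" "\<eta> \<le> \<epsilon>" using \<epsilon> by (auto simp: \<eta>_def)
  define t where "t = (\<lambda>n. nat \<lceil>(1 + \<epsilon>) * \<Delta> n\<rceil>)"
  define t' where "t' = (\<lambda>n. nat \<lceil>(1 - \<eta>) * \<Delta> n\<rceil>)"
  define s where "s = (\<lambda>n::nat. nat \<lfloor>p / 8 * real n\<rfloor>)"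
  define err where "err = (\<lambda>n. real n / fact (t n)
    + (exp (- (real (s n) * (real (s n choose t' n) * (q / real n) ^ t' n / 2)))
       + 2 ^ (2 * s n) * (1 - p / 2) ^ n))"
  have "err \<longlonglongrightarrow> 0 + (0 + 0)"
    unfolding err_def t_def t'_def s_def \<Delta>_def
    by (intro tendsto_add tendsto_n_over_fact tendsto_exp_binomial tendsto_few_weights)
      (use \<epsilon> \<eta> p q in auto)
  hence lim: "(\<lambda>n. 1 - err n) \<longlonglongrightarrow> 1"
    using tendsto_diff[OF tendsto_const[of "1::real"], of err 0] by simp
  have \<Delta>_pos: "eventually (\<lambda>n. 0 \<le> \<Delta> n) sequentially"
    unfolding \<Delta>_def by real_asymp
  show ?thesis
  proof (rule tendsto_sandwich[OF _ _ lim tendsto_const])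
    show "\<forall>\<^sub>F n in sequentially. 1 - err n \<le> \<P>(\<omega> in \<Omega> n.
            real (max_degree (I n \<omega>)) \<in> {(1 - \<epsilon>) * \<Delta> n .. (1 + \<epsilon>) * \<Delta> n})"
      using \<Delta>_pos eventually_ge_at_top[of 1]
    proof eventually_elim
      case (elim n)
      interpret prob_space "\<Omega> n" by (rule \<Omega>[OF elim(2)])
      have n: "0 < real n" using elim(2) by simp
      let ?\<kappa> = "\<lambda>z. k z / (c * real n)"
      have \<kappa>_le: "?\<kappa> (x, y) \<le> 1 / real n" if "x \<in> {0..1}" "y \<in> {0..1}" for x y
        using k_max[OF that] c n by (simp add: field_simps)
      interpret edge_kernel ?\<kappa>
      proof
        show "?\<kappa> \<in> borel_measurable (restrict_space borel ({0..1} \<times> {0..1}))"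
          by (intro borel_measurable_divide k_meas) auto
        fix x y :: real assume xy: "x \<in> {0..1}" "y \<in> {0..1}"
        have "1 / real n \<le> 1" using elim(2) by simp
        hence "?\<kappa> (x, y) \<le> 1" using \<kappa>_le[OF xy] by linarith
        thus "?\<kappa> (x, y) \<in> {0..1}" using k_range[OF xy] c n by simp
      qed
      have law: "prob {\<omega> \<in> space (\<Omega> n). Q (I n \<omega>)}
          = measure (inhomogeneous_random_graph n ?\<kappa>) {G \<in> simple_graphs n. Q G}" for Q
        unfolding I_law[OF elim(2), symmetric]
        using measurable_space[OF I[OF elim(2)]]
        by (subst measure_distr[OF I[OF elim(2)]]) (auto intro!: arg_cong[where f = prob])
      have events: "{\<omega> \<in> space (\<Omega> n). Q (I n \<omega>)} \<in> events" for Q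
      proof -
        have "I n -` {G \<in> simple_graphs n. Q G} \<inter> space (\<Omega> n) \<in> events"
          by (rule measurable_sets[OF I[OF elim(2)]]) auto
        moreover have "I n -` {G \<in> simple_graphs n. Q G} \<inter> space (\<Omega> n) = {\<omega> \<in> space (\<Omega> n). Q (I n \<omega>)}"
          using measurable_space[OF I[OF elim(2)]] by auto
        ultimately show ?thesis by simp
      qed
      let ?good = "\<lambda>G. real (max_degree G) \<in> {(1 - \<epsilon>) * \<Delta> n .. (1 + \<epsilon>) * \<Delta> n}"
      let ?high = "{\<omega> \<in> space (\<Omega> n). t n \<le> max_degree (I n \<omega>)}"
      let ?low = "{\<omega> \<in> space (\<Omega> n). max_degree (I n \<omega>) < t' n}"
      have "(1 - \<epsilon>) * \<Delta> n \<le> (1 - \<eta>) * \<Delta> n"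
        using elim(1) \<eta> by (intro mult_right_mono) auto
      hence "space (\<Omega> n) - {\<omega> \<in> space (\<Omega> n). ?good (I n \<omega>)} \<subseteq> ?high \<union> ?low"
        unfolding t_def t'_def by (auto simp: not_le) linarith+
      hence "prob (space (\<Omega> n) - {\<omega> \<in> space (\<Omega> n). ?good (I n \<omega>)}) \<le> prob (?high \<union> ?low)"
        by (intro finite_measure_mono sets.Un events)
      also have "\<dots> \<le> prob ?high + prob ?low"
        by (intro measure_Un_le events)
      also have "prob ?high \<le> real n / fact (t n)"
        unfolding law[of "\<lambda>G. t n \<le> max_degree G"] by (rule measure_max_degree_ge[OF elim(2) \<kappa>_le])
      also have "prob ?low \<le> exp (- (real (s n) * (real (s n choose t' n) * (q / real n) ^ t' n / 2)))
          + 2 ^ (2 * s n) * (1 - p / 2) ^ n"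
        unfolding law[of "\<lambda>G. max_degree G < t' n"] J(2)[symmetric]
      proof (rule measure_max_degree_less[OF elim(2) \<kappa>_le J(1)])
        fix x y assume "x \<in> {a<..<b}" "y \<in> {a<..<b}"
        from k_lower[OF this] show "q / real n \<le> ?\<kappa> (x, y)"
          using c n by (simp add: q_def field_simps)
      qed (use q n in auto)
      finally have "prob (space (\<Omega> n) - {\<omega> \<in> space (\<Omega> n). ?good (I n \<omega>)}) \<le> err n"
        by (simp add: err_def)
      thus ?case using prob_compl[OF events[of ?good]] by simp
    qed
    show "\<forall>\<^sub>F n in sequentially. \<P>(\<omega> in \<Omega> n.
            real (max_degree (I n \<omega>)) \<in> {(1 - \<epsilon>) * \<Delta> n .. (1 + \<epsilon>) * \<Delta> n}) \<le> 1"
      using eventually_ge_at_top[of 1] by eventually_elim (rule prob_space.prob_le_1[OF \<Omega>])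
  qed
qed

end
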